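(* Let $p$ be a prime number and $n$ a positive integer. Let $P(x), Q(x) \in \mathbb{Q}[x]$, with $Q(x)$ of degree at most $n$. Suppose that $Q(x)$ is an optimal $p$-adic approximator (of degree at most $n$) for $P(x)$ at a finite set $S \subset \mathbb{Q}$ with $|S| \ge n+1$. Then $P(x) - Q(x)$ has at least $n+1$ distinct zeros in $S$.
   Context: $|\cdot|_p$ is the $p$-adic absolute value on $\mathbb{Q}$: $|0|_p = 0$ and $|x|_p = p^{-v_p(x)}$ for $x \ne 0$, where $v_p$ is the $p$-adic valuation. For $P \in \mathbb{Q}[x]$ and a finite set $S \subset \mathbb{Q}$, a polynomial $Q \in \mathbb{Q}[x]$ of degree at most $n$ is an optimal $p$-adic approximator for $P$ at $S$ if it minimises $\sum_{s \in S} |Q(s) - P(s)|_p$ over all polynomials $Q\in\mathbb{Q}[x]$ of degree at most $n$. The zero polynomial counts as having degree at most $n$. *)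

theory Defs
  imports Complex_Main "HOL-Computational_Algebra.Computational_Algebra"
begin

text \<open>Here \<^term>\<open>quotient_of x\<close> is the pair of numerator and denominator of \<^term>\<open>x\<close> in
  lowest terms, with positive denominator. At \<^term>\<open>0\<close>, where the valuation is conventionally
  infinite, \<open>padic_val\<close> takes a junk value that \<open>padic_abs\<close> never uses.\<close>

definition padic_val :: "nat \<Rightarrow> rat \<Rightarrow> int" where
  "padic_val p x =
     int (multiplicity (int p) (fst (quotient_of x))) -
     int (multiplicity (int p) (snd (quotient_of x)))"

definition padic_abs :: "nat \<Rightarrow> rat \<Rightarrow> real" where
  "padic_abs p x = (if x = 0 then 0 else real p powi (- padic_val p x))"

definition optimal_padic_approximator ::
    "nat \<Rightarrow> nat \<Rightarrow> rat set \<Rightarrow> rat poly \<Rightarrow> rat poly \<Rightarrow> bool" where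
  "optimal_padic_approximator p n S P Q \<longleftrightarrow>
     degree Q \<le> n \<and>
     (\<forall>R. degree R \<le> n \<longrightarrow>
        (\<Sum>s\<in>S. padic_abs p (poly Q s - poly P s)) \<le>
        (\<Sum>s\<in>S. padic_abs p (poly R s - poly P s)))"

end

theory Submission
  imports Defs
begin

text \<open>Suppose that \<open>F = P - Q\<close> has a zero set \<open>Z\<close> in \<open>S\<close> with at most \<open>n\<close> elements, and let
  \<open>W\<close> be the monic polynomial with simple roots at \<open>Z\<close>. Pick \<open>s0 \<in> S - Z\<close> minimising
  \<open>|F s / W s|\<close> and put \<open>H = (F s0 / W s0) W\<close>. Then \<open>|H s| \<le> |F s|\<close> on \<open>S\<close>, so
  \<open>|F s - H s| \<le> |F s|\<close> by the ultrametric inequality, while \<open>F - H\<close> vanishes at \<open>s0\<close> and \<open>F\<close>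
  does not. Hence \<open>Q + H\<close> approximates \<open>P\<close> strictly better than \<open>Q\<close>.\<close>

text \<open>Frees \<open>padic_val\<close> from lowest terms, so that any convenient fraction may be
  used. Two fractions for the same rational cross-multiply to an integer identity, and the
  multiplicity of a prime is additive on nonzero products.\<close>

lemma padic_val_of_int_divide:
  assumes p: "prime p" and "a \<noteq> 0" "b \<noteq> 0"
  shows "padic_val p (of_int a / of_int b) =
    int (multiplicity (int p) a) - int (multiplicity (int p) b)"
proof -
  obtain u v where uv: "quotient_of (of_int a / of_int b) = (u, v)"
    by fastforce
  have v: "v > 0"
    using quotient_of_denom_pos[OF uv] .
  have eq: "(of_int a / of_int b :: rat) = of_int u / of_int v"
    using quotient_of_div[OF uv] .
  with v assms have "of_int (a * v) = (of_int (u * b) :: rat)"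
    by (simp add: field_simps)
  then have *: "a * v = u * b"
    by (simp only: of_int_eq_iff)
  with v assms have "u \<noteq> 0"
    by auto
  have "prime_elem (int p)"
    using p by simp
  then have "multiplicity (int p) a + multiplicity (int p) v =
      multiplicity (int p) u + multiplicity (int p) b"
    using * v assms \<open>u \<noteq> 0\<close>
      prime_elem_multiplicity_mult_distrib[of "int p" a v]
      prime_elem_multiplicity_mult_distrib[of "int p" u b] by simp
  then show ?thesis
    by (simp add: padic_val_def uv)
qed

text \<open>Over a shared denominator, a difference of rationals becomes a difference of integer
  numerators.\<close>

lemma rat_common_denominator:
  fixes x y :: rat
  obtains a b c where "c \<noteq> 0" "x = of_int a / of_int c" "y = of_int b / of_int c"
proof -
  obtain a c where x: "c > 0" "x = of_int a / of_int c"
    by (cases "quotient_of x") (use quotient_of_div quotient_of_denom_pos in blast)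
  obtain b d where y: "d > 0" "y = of_int b / of_int d"
    by (cases "quotient_of y") (use quotient_of_div quotient_of_denom_pos in blast)
  show thesis
    by (rule that[of "c * d" "a * d" "b * c"]) (use x y in auto)
qed

lemma padic_val_mult:
  assumes p: "prime p" and "x \<noteq> 0" "y \<noteq> 0"
  shows "padic_val p (x * y) = padic_val p x + padic_val p y"
proof -
  obtain a b c where *: "c \<noteq> 0" "x = of_int a / of_int c" "y = of_int b / of_int c"
    by (rule rat_common_denominator)
  then have nz: "a \<noteq> 0" "b \<noteq> 0"
    using assms by auto
  have "prime_elem (int p)"
    using p by simp
  moreover have "x * y = of_int (a * b) / of_int (c * c)"
    using * by simp
  moreover have "padic_val p (of_int (a * b) / of_int (c * c)) =
      int (multiplicity (int p) (a * b)) - int (multiplicity (int p) (c * c))"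
    using p * nz by (intro padic_val_of_int_divide) auto
  ultimately show ?thesis
    using p * nz by (simp add: padic_val_of_int_divide prime_elem_multiplicity_mult_distrib)
qed

text \<open>A power of \<open>p\<close> dividing both numerators divides their difference. The case
  \<open>x = y\<close> must be excluded because \<open>padic_val p 0\<close> is \<open>0\<close>,
  not infinity.\<close>

lemma padic_val_diff_ge:
  assumes p: "prime p" and "x \<noteq> 0" "y \<noteq> 0" "x \<noteq> y"
  shows "min (padic_val p x) (padic_val p y) \<le> padic_val p (x - y)"
proof -
  obtain a b c where *: "c \<noteq> 0" "x = of_int a / of_int c" "y = of_int b / of_int c"
    by (rule rat_common_denominator)
  then have nz: "a \<noteq> 0" "b \<noteq> 0" "a - b \<noteq> 0"
    using assms by auto
  define m where "m = min (multiplicity (int p) a) (multiplicity (int p) b)"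
  have "int p ^ m dvd a - b"
    by (intro dvd_diff multiplicity_dvd') (simp_all add: m_def)
  then have "m \<le> multiplicity (int p) (a - b)"
    using nz p by (intro multiplicity_geI) (auto simp: prime_nat_iff)
  moreover have "x - y = of_int (a - b) / of_int c"
    using * by (simp add: diff_divide_distrib)
  ultimately show ?thesis
    using p * nz padic_val_of_int_divide[OF p nz(3) *(1)]
    by (simp add: padic_val_of_int_divide m_def)
qed

lemma padic_abs_0 [simp]: "padic_abs p 0 = 0"
  by (simp add: padic_abs_def)

lemma padic_abs_pos: "prime p \<Longrightarrow> x \<noteq> 0 \<Longrightarrow> padic_abs p x > 0"
  by (simp add: padic_abs_def prime_gt_0_nat)

lemma padic_abs_mult: "prime p \<Longrightarrow> padic_abs p (x * y) = padic_abs p x * padic_abs p y"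
  by (auto simp: padic_abs_def padic_val_mult prime_gt_0_nat simp flip: power_int_add)

lemma padic_abs_divide:
  assumes "prime p"
  shows "padic_abs p (x / y) = padic_abs p x / padic_abs p y"
proof (cases "y = 0")
  case False
  then have "padic_abs p (x / y) * padic_abs p y = padic_abs p x"
    using assms by (simp flip: padic_abs_mult)
  then show ?thesis
    using padic_abs_pos[OF assms False] by (simp add: field_simps)
\<comment> \<open>For \<open>y = 0\<close> both sides are \<open>0\<close>, since division by zero
  yields \<open>0\<close>.\<close>
qed simp

lemma padic_abs_uminus: "padic_abs p (- x) = padic_abs p x"
  by (cases "quotient_of x")
     (simp add: padic_abs_def padic_val_def rat_uminus_code)

lemma padic_abs_diff_le:
  assumes p: "prime p"
  shows "padic_abs p (x - y) \<le> max (padic_abs p x) (padic_abs p y)"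
\<comment> \<open>Split off the cases in which some argument of \<open>padic_abs\<close> is
  \<open>0\<close> and the valuation says nothing.\<close>
proof (cases "x = 0 \<or> y = 0 \<or> x = y")
  case True
  then show ?thesis
    using p padic_abs_pos[OF p, of x] by (cases "x = 0") (auto simp: padic_abs_uminus)
next
  case False
  have "real p \<ge> 1"
    using p prime_ge_1_nat by force
  \<comment> \<open>The exponent is negated, so lower bounds on valuations become upper bounds on
    absolute values.\<close>
  then have mono: "real p powi (- j) \<le> real p powi (- i)" if "i \<le> j" for i j
    using that by (intro power_int_increasing) auto
  show ?thesis
    using False padic_val_diff_ge[OF p, of x y] mono
    by (auto simp: padic_abs_def le_max_iff_disj min_le_iff_disj)
qed

theorem theorem4:
  fixes p n :: nat and P Q :: "rat poly" and S :: "rat set"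
  assumes "prime p"
    and "n \<ge> 1"
    and "degree Q \<le> n"
    and "finite S"
    and "card S \<ge> n + 1"
    and "optimal_padic_approximator p n S P Q"
  shows "card {s \<in> S. poly (P - Q) s = 0} \<ge> n + 1"
proof (rule ccontr)
  note p = assms(1)
  define Z where "Z = {s \<in> S. poly (P - Q) s = 0}"
  assume "\<not> ?thesis"
  then have cardZ: "card Z \<le> n"
    by (simp add: Z_def)
  have Z: "finite Z" "Z \<subseteq> S"
    using assms(4) by (auto simp: Z_def)
  \<comment> \<open>The size of \<open>S\<close> enters here:
    \<open>card Z \<le> n < card S\<close>.\<close>
  have ne: "S - Z \<noteq> {}"
    using cardZ assms(5) Z by (metis Diff_eq_empty_iff add_le_same_cancel1 card_mono le_trans not_one_le_zero)
  define F where "F = (\<lambda>s. poly (P - Q) s)"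
  define W where "W = (\<Prod>z\<in>Z. [:- z, 1:])"
  have W0: "poly W s = 0 \<longleftrightarrow> s \<in> Z" for s
    using Z(1) by (auto simp: W_def poly_prod)
  have F0: "F s = 0 \<longleftrightarrow> s \<in> Z" if "s \<in> S" for s
    using that by (simp add: F_def Z_def)
  have degW: "degree W = card Z"
    unfolding W_def by (subst degree_prod_eq_sum_degree) auto
  obtain s0 where s0: "s0 \<in> S - Z"
    and min: "\<And>s. s \<in> S - Z \<Longrightarrow>
      padic_abs p (F s0 / poly W s0) \<le> padic_abs p (F s / poly W s)"
    using assms(4) ne ex_is_arg_min_if_finite[of "S - Z" "\<lambda>s. padic_abs p (F s / poly W s)"]
    by (auto simp: is_arg_min_linorder)
  define H where "H = smult (F s0 / poly W s0) W"
  have H_le: "padic_abs p (poly H s) \<le> padic_abs p (F s)" if "s \<in> S" for s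
  proof (cases "s \<in> Z")
    case True
    then show ?thesis
      using W0[of s] F0[of s] that by (simp add: H_def)
  next
    case False
    then have "padic_abs p (poly W s) > 0"
      using W0 padic_abs_pos[OF p] by blast
    \<comment> \<open>Multiply the minimality of the quotient at \<open>s0\<close> by the positive
      number \<open>padic_abs p (poly W s)\<close>.\<close>
    then show ?thesis
      using min[of s] False that
      by (simp add: H_def padic_abs_mult[OF p] padic_abs_divide[OF p] field_simps)
  qed
  have "(\<Sum>s\<in>S. padic_abs p (F s - poly H s)) < (\<Sum>s\<in>S. padic_abs p (F s))"
  proof (rule sum_strict_mono_ex1[OF assms(4)])
    show "\<forall>s\<in>S. padic_abs p (F s - poly H s) \<le> padic_abs p (F s)"
      using H_le padic_abs_diff_le[OF p] by (metis max.absorb1)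
    have "F s0 - poly H s0 = 0"
      using s0 W0 by (simp add: H_def)
    moreover have "padic_abs p (F s0) > 0"
      using s0 F0 padic_abs_pos[OF p] by blast
    ultimately show "\<exists>s\<in>S. padic_abs p (F s - poly H s) < padic_abs p (F s)"
      using s0 by (intro bexI[of _ s0]) auto
  qed
  \<comment> \<open>Optimality is stated with \<open>Q - P\<close> while \<open>F\<close> is
    \<open>P - Q\<close>; the sign does not affect the absolute value.\<close>
  moreover have "padic_abs p (poly (Q + H) s - poly P s) = padic_abs p (F s - poly H s)" for s
    using padic_abs_uminus[of p "F s - poly H s"] by (simp add: F_def algebra_simps)
  moreover have "padic_abs p (poly Q s - poly P s) = padic_abs p (F s)" for s
    using padic_abs_uminus[of p "F s"] by (simp add: F_def)
  \<comment> \<open>\<open>H\<close> is a multiple of \<open>W\<close>, whose degree is the number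
    of zeros, so having at most \<open>n\<close> zeros makes \<open>Q + H\<close> an admissible
    competitor.\<close>
  moreover have "degree (Q + H) \<le> n"
    using assms(3) cardZ degW degree_smult_le[of "F s0 / poly W s0" W]
    by (intro degree_add_le) (auto simp: H_def)
  ultimately show False
    using assms(6) by (auto simp: optimal_padic_approximator_def dest: spec[of _ "Q + H"])
qed

end
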